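(* Let $r\ge 1$ and $s\ge 1$ be integers and let $G$ be a graph on $n$ vertices. Then: (1) If $\lambda(\overline{K}_s\vee G)\ge \lambda(\overline{K}_s\vee T_r(n))$, then $\lambda(G)\ge \lambda(T_r(n))$. Moreover, if in addition $\lambda(G)=\lambda(T_r(n))$, then $G\in\mathcal{F}_r(n)$ and $\lambda(\overline{K}_s\vee G)=\lambda(\overline{K}_s\vee T_r(n))$. (2) If $\lambda(\overline{K}_s\vee G)>\lambda(\overline{K}_s\vee T_r(n))$, then $\lambda(G)>\lambda(T_r(n))$. (3) If $\lambda(\overline{K}_s\vee G)=\lambda(\overline{K}_s\vee T_r(n))$ and $\lambda(G)=\lambda(T_r(n))$, then $G\in\mathcal{F}_r(n)$.
   Context: All graphs are finite and simple; $\lambda(\cdot)$ is the spectral radius of the adjacency matrix. $T_r(n)$ is the complete $r$-partite graph on $n$ vertices with part sizes differing by at most one (so $T_1(n)$ is the edgeless graph). $\overline{K}_s$ is the edgeless graph on $s$ vertices, and $G\vee H$ (the join) is the graph obtained from disjoint copies of $G$ and $H$ by adding all edges between them. The family $\mathcal{F}_r(n)$: write $n=ra+b$ with $0\le b<r$ and $a=\lfloor n/r\rfloor$. If $b=0$, $\mathcal{F}_r(n)$ is the set of all $(r-1)a$-regular graphs on $n$ vertices. If $1\le b<r$, $\mathcal{F}_r(n)$ is the set of all graphs $G$ on $n$ vertices having a partition $V(G)=X\sqcup Y$ with $|X|=b(a+1)$, $|Y|=(r-b)a$, such that every vertex of $X$ is adjacent to every vertex of $Y$, $G[X]$ is $(b-1)(a+1)$-regular,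 and $G[Y]$ is $(r-b-1)a$-regular. *)

theory Defs
  imports "Jordan_Normal_Form.Spectral_Radius"
begin

definition is_graph :: "nat \<Rightarrow> (nat \<Rightarrow> nat \<Rightarrow> bool) \<Rightarrow> bool" where
  "is_graph n E \<longleftrightarrow> (\<forall>i j. E i j \<longrightarrow> i < n \<and> j < n \<and> i \<noteq> j \<and> E j i)"

definition adj_mat :: "nat \<Rightarrow> (nat \<Rightarrow> nat \<Rightarrow> bool) \<Rightarrow> complex mat" where
  "adj_mat n E = mat n n (\<lambda>(i, j). if E i j then 1 else 0)"

definition lam :: "nat \<Rightarrow> (nat \<Rightarrow> nat \<Rightarrow> bool) \<Rightarrow> real" where
  "lam n E = spectral_radius (adj_mat n E)"

text \<open>Turan graph T_r(n): vertex i lies in part (i mod r); parts differ in size by at most one.\<close>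
definition turan :: "nat \<Rightarrow> nat \<Rightarrow> nat \<Rightarrow> nat \<Rightarrow> bool" where
  "turan r n i j \<longleftrightarrow> i < n \<and> j < n \<and> i mod r \<noteq> j mod r"

definition join_empty :: "nat \<Rightarrow> nat \<Rightarrow> (nat \<Rightarrow> nat \<Rightarrow> bool) \<Rightarrow> nat \<Rightarrow> nat \<Rightarrow> bool" where
  "join_empty s n E i j \<longleftrightarrow>
     (i < s \<and> s \<le> j \<and> j < s + n) \<or> (j < s \<and> s \<le> i \<and> i < s + n) \<or>
     (s \<le> i \<and> s \<le> j \<and> E (i - s) (j - s))"

definition deg_in :: "(nat \<Rightarrow> nat \<Rightarrow> bool) \<Rightarrow> nat set \<Rightarrow> nat \<Rightarrow> nat" where
  "deg_in E S v = card {u \<in> S. E v u}"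

definition regular_on :: "(nat \<Rightarrow> nat \<Rightarrow> bool) \<Rightarrow> nat set \<Rightarrow> nat \<Rightarrow> bool" where
  "regular_on E S k \<longleftrightarrow> (\<forall>v\<in>S. deg_in E S v = k)"

definition family_F :: "nat \<Rightarrow> nat \<Rightarrow> (nat \<Rightarrow> nat \<Rightarrow> bool) \<Rightarrow> bool" where
  "family_F r n E \<longleftrightarrow>
     (let a = n div r; b = n mod r in
      if b = 0 then regular_on E {0..<n} ((r - 1) * a)
      else (\<exists>X Y. X \<union> Y = {0..<n} \<and> X \<inter> Y = {} \<and>
              card X = b * (a + 1) \<and> card Y = (r - b) * a \<and>
              (\<forall>x\<in>X. \<forall>y\<in>Y. E x y) \<and>
              regular_on E X ((b - 1) * (a + 1)) \<and>
              regular_on E Y ((r - b - 1) * a)))"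

end

theory Submission
  imports Defs "HOL-Analysis.Function_Topology" "HOL-Analysis.Convex"
begin

text \<open>
  Let A be the adjacency matrix of G, let B = J - A, let k_i be the row sums of B, and put
  a = n div r. For t > lam G let y solve (t + B) y = 1 and let g(t) be the sum of its entries.
  Then 0 < g < 1 and g' = - |y|^2, and the spectral radius rho of the join satisfies
  g(rho) = rho / (rho + s).

  Writing L for the Laplacian of the complement, so that B = diag(k) - L, and u_i = k_i - a,
  n - (2t + 2a + 1) g + (t + a)(t + a + 1) |y|^2 equals
  sum_i u_i (u_i - 1) y_i^2 + (2t + 2a + 1) y^T L y - |L y|^2.
  The first sum is nonnegative because the u_i are integers, and |L y|^2 is at most
  2(n - 1) y^T L y by Cauchy-Schwarz. Hence (t + a)(t + a + 1) g(t) - n t is nonincreasing as long as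
  2t + 2a + 1 >= 2n - 1, which holds from t = lam (T_r(n)) onwards. For the Turan graph this function
  is constant and g(lam) = 1. So lam G <= lam T forces g_G <= g_T beyond lam T, hence the same
  inequality for the joins, and equality at one point forces the derivative to vanish:
  then all k_i lie in {a, a + 1} and y is constant along the edges of the complement.
\<close>

subsection \<open>Rayleigh quotients\<close>

definition dot :: "nat \<Rightarrow> (nat \<Rightarrow> real) \<Rightarrow> (nat \<Rightarrow> real) \<Rightarrow> real" where
  "dot n x y = (\<Sum>i<n. x i * y i)"

definition matvec :: "nat \<Rightarrow> (nat \<Rightarrow> nat \<Rightarrow> real) \<Rightarrow> (nat \<Rightarrow> real) \<Rightarrow> nat \<Rightarrow> real" where
  "matvec n C x i = (\<Sum>j<n. C i j * x j)"

lemma dot_commute: "dot n x y = dot n y x"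
  by (simp add: dot_def mult.commute)

lemma dot_add_left: "dot n (\<lambda>i. x i + y i) z = dot n x z + dot n y z"
  by (simp add: dot_def algebra_simps sum.distrib)

lemma dot_scale_left: "dot n (\<lambda>i. c * x i) z = c * dot n x z"
  by (simp add: dot_def sum_distrib_left mult.assoc)

lemma dot_add_right: "dot n z (\<lambda>i. x i + y i) = dot n z x + dot n z y"
  by (simp add: dot_def algebra_simps sum.distrib)

lemma dot_scale_right: "dot n z (\<lambda>i. c * x i) = c * dot n z x"
  by (simp add: dot_def sum_distrib_left algebra_simps)

lemma dot_cong: "(\<And>i. i < n \<Longrightarrow> x i = x' i) \<Longrightarrow> (\<And>i. i < n \<Longrightarrow> y i = y' i) \<Longrightarrow> dot n x y = dot n x' y'"
  by (auto simp: dot_def intro!: sum.cong)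

lemma dot_self_nonneg: "0 \<le> dot n x x"
  by (simp add: dot_def sum_nonneg)

lemma dot_self_eq_0: "dot n x x = 0 \<Longrightarrow> i < n \<Longrightarrow> x i = 0"
  by (simp add: dot_def sum_nonneg_eq_0_iff)

lemma dot_self_pos: "i < n \<Longrightarrow> x i \<noteq> 0 \<Longrightarrow> 0 < dot n x x"
  using dot_self_nonneg[of n x] dot_self_eq_0[of n x i] by force

lemma matvec_add: "matvec n C (\<lambda>i. x i + y i) i = matvec n C x i + matvec n C y i"
  by (simp add: matvec_def algebra_simps sum.distrib)

lemma matvec_scale: "matvec n C (\<lambda>i. c * x i) i = c * matvec n C x i"
  by (simp add: matvec_def sum_distrib_left algebra_simps)

lemma dot_matvec: "dot n x (matvec n C y) = (\<Sum>i<n. \<Sum>j<n. C i j * x i * y j)"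
  by (simp add: dot_def matvec_def sum_distrib_left algebra_simps)

lemma dot_matvec_sym:
  assumes "\<And>i j. C i j = C j i"
  shows "dot n x (matvec n C y) = dot n (matvec n C x) y"
proof -
  have "dot n x (matvec n C y) = (\<Sum>j<n. \<Sum>i<n. C i j * x i * y j)"
    unfolding dot_matvec by (rule sum.swap)
  also have "\<dots> = dot n y (matvec n C x)"
    unfolding dot_matvec using assms by (intro sum.cong refl) (simp add: mult_ac)
  finally show ?thesis by (simp add: dot_commute)
qed

text \<open>Vectors are functions on all of \<open>nat\<close>, so the coordinates from
  \<open>n\<close> on are pinned to 0. The sphere is then a closed subset of a product of compact
  intervals, compact by Tychonoff.\<close>

lemma compact_sphere: "compact {x :: nat \<Rightarrow> real. (\<forall>i\<ge>n. x i = 0) \<and> dot n x x = 1}"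
proof -
  let ?S = "\<lambda>i. if i < n then {-1..1::real} else {0}"
  have "compactin (product_topology (\<lambda>_. euclidean) UNIV) (PiE UNIV ?S)"
    unfolding compactin_PiE by (intro disjI2) auto
  then have "compact (PiE UNIV ?S)"
    by (simp add: euclidean_product_topology)
  moreover have "closed {x. dot n x x = 1}"
    unfolding dot_def
    by (intro closed_Collect_eq continuous_intros continuous_on_product_coordinates)
  ultimately have c: "compact (PiE UNIV ?S \<inter> {x. dot n x x = 1})"
    by (rule compact_Int_closed)
  have "\<bar>x i\<bar> \<le> 1" if "dot n x x = 1" "i < n" for x :: "nat \<Rightarrow> real" and i
  proof -
    have "(x i)\<^sup>2 \<le> dot n x x"
      unfolding dot_def power2_eq_square[symmetric] using that
      by (intro member_le_sum) auto
    then show ?thesis using that by (simp add: abs_square_le_1)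
  qed
  then have "{x. (\<forall>i\<ge>n. x i = 0) \<and> dot n x x = 1} = PiE UNIV ?S \<inter> {x. dot n x x = 1}"
    by (auto simp: PiE_iff split: if_splits) (force simp: abs_le_iff)+
  with c show ?thesis by simp
qed

text \<open>A continuous quadratic form attains its maximum on the compact sphere; homogeneity
  carries the bound over to every \<open>z\<close>.\<close>

lemma rayleigh_max:
  assumes n: "n \<ge> 1"
  obtains x where "dot n x x = 1" "\<And>z. dot n z (matvec n C z) \<le> dot n x (matvec n C x) * dot n z z"
proof -
  let ?S = "{x :: nat \<Rightarrow> real. (\<forall>i\<ge>n. x i = 0) \<and> dot n x x = 1}"
  have "(\<lambda>i. if i = 0 then 1 else 0) \<in> ?S"
    using n by (auto simp: dot_def if_distrib[of "\<lambda>x. x * _"] cong: if_cong)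
  then have ne: "?S \<noteq> {}" by (metis empty_iff)
  have "continuous_on ?S (\<lambda>x. dot n x (matvec n C x))"
    unfolding dot_matvec
    by (intro continuous_intros continuous_on_subset[OF continuous_on_product_coordinates]) auto
  from continuous_attains_sup[OF compact_sphere ne this]
  obtain x where x: "x \<in> ?S" "\<And>y. y \<in> ?S \<Longrightarrow> dot n y (matvec n C y) \<le> dot n x (matvec n C x)"
    by (elim bexE) (rule that, auto)
  have "dot n z (matvec n C z) \<le> dot n x (matvec n C x) * dot n z z" for z
  proof (cases "dot n z z = 0")
    case True
    then have "dot n z (matvec n C z) = 0"
      using dot_self_eq_0[OF True] by (simp add: dot_def)
    with True show ?thesis by simp
  next
    case False
    then have pos: "dot n z z > 0" using dot_self_nonneg[of n z] by simp
    define c where "c = inverse (sqrt (dot n z z))"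
    have c: "c * (c * dot n z z) = 1" "c > 0"
      using pos by (auto simp: c_def field_simps)
    define y where "y i = (if i < n then c * z i else 0)" for i
    have "dot n y y = c * (c * dot n z z)"
      by (subst dot_cong[of n y "\<lambda>i. c * z i" y "\<lambda>i. c * z i"])
        (auto simp: y_def dot_scale_left dot_scale_right)
    then have "y \<in> ?S" using c by (auto simp: y_def)
    then have "dot n y (matvec n C y) \<le> dot n x (matvec n C x)" by (rule x)
    moreover have "dot n y (matvec n C y) = c * (c * dot n z (matvec n C z))"
      by (simp add: dot_matvec y_def sum_distrib_left mult_ac)
    ultimately have "c * (c * dot n z (matvec n C z)) \<le> dot n x (matvec n C x) * (c * (c * dot n z z))"
      using c by simp
    then have "c * c * dot n z (matvec n C z) \<le> c * c * (dot n x (matvec n C x) * dot n z z)"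
      by (simp add: mult_ac)
    then show ?thesis using c by simp
  qed
  with x show ?thesis by (intro that[of x]) auto
qed

text \<open>First-order variation: moving \<open>x\<close> by \<open>e\<close> times the residual
  \<open>r = C x - m x\<close> changes the form by \<open>2 * e * dot n r r\<close> up to a term of
  order \<open>e\<^sup>2\<close>. Maximality rules out a gain for small \<open>e > 0\<close>, so the
  residual is zero.\<close>

lemma maximiser_is_eigenvector:
  assumes sym: "\<And>i j. C i j = C j i"
    and le: "\<And>z. dot n z (matvec n C z) \<le> m * dot n z z"
    and eq: "dot n x (matvec n C x) = m * dot n x x"
    and i: "i < n"
  shows "matvec n C x i = m * x i"
proof -
  define r where "r i = matvec n C x i + (- m) * x i" for i
  define K where "K = m * dot n r r - dot n r (matvec n C r)"
  have rr: "dot n r (matvec n C x) - m * dot n r x = dot n r r"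
    unfolding r_def[abs_def] by (simp only: dot_add_left dot_add_right dot_scale_left dot_scale_right)
      (simp add: algebra_simps dot_commute)
  have *: "2 * e * dot n r r \<le> e\<^sup>2 * K" for e
  proof -
    let ?z = "\<lambda>i. x i + e * r i"
    have matvec: "matvec n C ?z = (\<lambda>i. matvec n C x i + e * matvec n C r i)"
      by (simp add: fun_eq_iff matvec_add matvec_scale)
    have s: "dot n x (matvec n C r) = dot n r (matvec n C x)"
      by (subst dot_matvec_sym[of C, OF sym]) (rule dot_commute)
    have "dot n ?z (matvec n C ?z) = dot n x (matvec n C x) + 2 * e * dot n r (matvec n C x) + e\<^sup>2 * dot n r (matvec n C r)"
      unfolding matvec by (simp add: dot_add_left dot_add_right dot_scale_left dot_scale_right s
        algebra_simps power2_eq_square)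
    moreover have "dot n ?z ?z = dot n x x + 2 * e * dot n r x + e\<^sup>2 * dot n r r"
      by (simp add: dot_add_left dot_add_right dot_scale_left dot_scale_right dot_commute[of n x r]
        algebra_simps power2_eq_square)
    ultimately have "2 * e * (dot n r (matvec n C x) - m * dot n r x) \<le> e\<^sup>2 * K"
      using le[of ?z] eq by (simp add: K_def algebra_simps)
    then show ?thesis by (simp add: rr)
  qed
  have "dot n r r = 0"
  proof (rule ccontr)
    assume "dot n r r \<noteq> 0"
    then have pos: "dot n r r > 0" using dot_self_nonneg[of n r] by simp
    \<comment> \<open>Chosen so that \<open>e * (\<bar>K\<bar> + 1)\<close> is exactly
      \<open>dot n r r\<close>, which is less than the \<open>2 * dot n r r\<close> that
      \<open>*\<close> would require; the added 1 keeps the denominator positive.\<close>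
    define e where "e = dot n r r / (\<bar>K\<bar> + 1)"
    have e: "e > 0" using pos by (simp add: e_def)
    have "e * (2 * dot n r r) \<le> e * (e * K)" using *[of e] by (simp add: power2_eq_square mult_ac)
    then have "2 * dot n r r \<le> e * K" using e by simp
    also have "\<dots> \<le> e * (\<bar>K\<bar> + 1)" using e by (intro mult_left_mono) auto
    also have "\<dots> = dot n r r" by (simp add: e_def)
    finally show False using pos by simp
  qed
  from dot_self_eq_0[OF this i] show ?thesis by (simp add: r_def)
qed

text \<open>For a nonnegative matrix, replacing a maximiser by its entrywise absolute value cannot
  lower the quadratic form, so the absolute value is a maximiser too and hence an
  eigenvector.\<close>

lemma perron:
  assumes n: "n \<ge> 1" and sym: "\<And>i j. C i j = C j i" and nn: "\<And>i j. C i j \<ge> 0"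
  obtains m x where "\<And>i. i < n \<Longrightarrow> x i \<ge> 0" "dot n x x = 1" "\<And>i. i < n \<Longrightarrow> matvec n C x i = m * x i"
    "\<And>z. dot n z (matvec n C z) \<le> m * dot n z z"
proof -
  obtain x where x: "dot n x x = 1" "\<And>z. dot n z (matvec n C z) \<le> dot n x (matvec n C x) * dot n z z"
    using rayleigh_max[of n C, OF n] by blast
  define m where "m = dot n x (matvec n C x)"
  have 1: "dot n (\<lambda>i. \<bar>x i\<bar>) (\<lambda>i. \<bar>x i\<bar>) = 1" using x(1) by (simp add: dot_def)
  have "dot n (\<lambda>i. \<bar>x i\<bar>) (matvec n C (\<lambda>i. \<bar>x i\<bar>)) \<ge> m"
    unfolding m_def dot_matvec
    by (intro sum_mono) (metis abs_ge_self abs_mult abs_of_nonneg nn)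
  moreover have "dot n (\<lambda>i. \<bar>x i\<bar>) (matvec n C (\<lambda>i. \<bar>x i\<bar>)) \<le> m"
    using x(2)[of "\<lambda>i. \<bar>x i\<bar>"] 1 by (simp add: m_def)
  ultimately have "dot n (\<lambda>i. \<bar>x i\<bar>) (matvec n C (\<lambda>i. \<bar>x i\<bar>)) = m * dot n (\<lambda>i. \<bar>x i\<bar>) (\<lambda>i. \<bar>x i\<bar>)"
    using 1 by simp
  from maximiser_is_eigenvector[OF sym _ this] x(2)
  have "matvec n C (\<lambda>i. \<bar>x i\<bar>) i = m * \<bar>x i\<bar>" if "i < n" for i
    using that by (simp add: m_def)
  with 1 x(2) show ?thesis by (intro that[of "\<lambda>i. \<bar>x i\<bar>" m]) (auto simp: m_def)
qed

subsection \<open>The spectral radius of a graph\<close>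

definition adj :: "(nat \<Rightarrow> nat \<Rightarrow> bool) \<Rightarrow> nat \<Rightarrow> nat \<Rightarrow> real" where
  "adj E i j = of_bool (E i j)"

lemma adj_nonneg: "adj E i j \<ge> 0"
  by (simp add: adj_def)

lemma adj_sym: "is_graph n E \<Longrightarrow> adj E i j = adj E j i"
  by (auto simp: adj_def is_graph_def)

lemma adj_mat_carrier: "adj_mat n E \<in> carrier_mat n n"
  by (simp add: adj_mat_def)

lemma adj_mat_eigenvector_iff:
  assumes "v \<in> carrier_vec n"
  shows "adj_mat n E *\<^sub>v v = c \<cdot>\<^sub>v v \<longleftrightarrow> (\<forall>i<n. (\<Sum>j<n. of_real (adj E i j) * v $ j) = c * v $ i)"
proof -
  have "(adj_mat n E *\<^sub>v v) $ i = (\<Sum>j<n. of_real (adj E i j) * v $ j)" if "i < n" for i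
    using that assms
    by (auto simp: adj_mat_def scalar_prod_def adj_def lessThan_atLeast0 intro!: sum.cong)
  moreover have "dim_vec (adj_mat n E *\<^sub>v v) = n" by (simp add: adj_mat_def)
  ultimately show ?thesis using assms by (auto simp: vec_eq_iff)
qed

text \<open>The bridge between the complex spectrum and real quadratic forms. The vector
  \<open>x\<close> shows that \<open>m\<close> is an eigenvalue. Conversely, the moduli
  \<open>z\<close> of any complex eigenvector for \<open>c\<close> satisfy
  \<open>norm c * z i \<le> (A z) i\<close> by the triangle inequality, and the Rayleigh bound
  yields \<open>norm c \<le> m\<close>.\<close>

lemma lam_eqI:
  assumes n: "n \<ge> 1" and x: "\<And>i. i < n \<Longrightarrow> x i \<ge> 0" "dot n x x = 1"
    "\<And>i. i < n \<Longrightarrow> matvec n (adj E) x i = m * x i"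
    "\<And>z. dot n z (matvec n (adj E) z) \<le> m * dot n z z"
  shows "lam n E = m"
proof -
  have "dot n x (matvec n (adj E) x) = m"
    using x(2,3) dot_cong[of n x x "matvec n (adj E) x" "\<lambda>i. m * x i"] by (simp add: dot_scale_right)
  moreover have "dot n x (matvec n (adj E) x) \<ge> 0"
    unfolding dot_matvec using x(1) adj_nonneg by (intro sum_nonneg) auto
  ultimately have m0: "m \<ge> 0" by simp
  have "m \<le> lam n E"
  proof -
    define v where "v = vec n (\<lambda>i. complex_of_real (x i))"
    have v: "v \<in> carrier_vec n" by (simp add: v_def)
    have "v \<noteq> 0\<^sub>v n"
    proof
      assume "v = 0\<^sub>v n"
      then have "x i = 0" if "i < n" for i
        using that by (metis v_def index_vec index_zero_vec(1) of_real_eq_0_iff)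
      then show False using x(2) by (simp add: dot_def)
    qed
    moreover have "adj_mat n E *\<^sub>v v = complex_of_real m \<cdot>\<^sub>v v"
      unfolding adj_mat_eigenvector_iff[OF v]
      using x(3) by (simp add: v_def matvec_def flip: of_real_mult of_real_sum)
    ultimately have "complex_of_real m \<in> spectrum (adj_mat n E)"
      using v by (auto simp: spectrum_def eigenvalue_def eigenvector_def adj_mat_def)
    from spectral_radius_mem_max(2)[OF adj_mat_carrier _ imageI[OF this]] n m0
    show ?thesis by (simp add: lam_def)
  qed
  moreover have "lam n E \<le> m"
  proof -
    obtain c where c: "c \<in> spectrum (adj_mat n E)" "lam n E = norm c"
      using spectral_radius_mem_max(1)[OF adj_mat_carrier, of n E] n by (auto simp: lam_def)
    then obtain v where v: "v \<in> carrier_vec n" "v \<noteq> 0\<^sub>v n" "adj_mat n E *\<^sub>v v = c \<cdot>\<^sub>v v"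
      by (auto simp: spectrum_def eigenvalue_def eigenvector_def adj_mat_def)
    define z where "z i = norm (v $ i)" for i
    obtain i0 where "i0 < n" "z i0 \<noteq> 0"
      using v(1,2) by (auto simp: z_def vec_eq_iff)
    then have pos: "dot n z z > 0" by (rule dot_self_pos)
    have "norm c * z i \<le> matvec n (adj E) z i" if "i < n" for i
    proof -
      have "norm c * z i = norm (\<Sum>j<n. of_real (adj E i j) * v $ j)"
        using v that adj_mat_eigenvector_iff[OF v(1)] by (simp add: z_def norm_mult)
      also have "\<dots> \<le> (\<Sum>j<n. norm (of_real (adj E i j) * v $ j))" by (rule norm_sum)
      also have "\<dots> = matvec n (adj E) z i"
        using adj_nonneg by (simp add: matvec_def z_def norm_mult)
      finally show ?thesis .
    qed
    then have "norm c * dot n z z \<le> dot n z (matvec n (adj E) z)"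
      unfolding dot_scale_right[symmetric] unfolding dot_def
      by (intro sum_mono mult_left_mono) (auto simp: z_def)
    also have "\<dots> \<le> m * dot n z z" by (rule x(4))
    finally show ?thesis using pos c by simp
  qed
  ultimately show ?thesis by simp
qed

lemma lam_perron:
  assumes n: "n \<ge> 1" and G: "is_graph n E"
  obtains x where "\<And>i. i < n \<Longrightarrow> x i \<ge> 0" "dot n x x = 1"
    "\<And>i. i < n \<Longrightarrow> matvec n (adj E) x i = lam n E * x i"
    "\<And>z. dot n z (matvec n (adj E) z) \<le> lam n E * dot n z z"
proof (rule perron[of n "adj E", OF n adj_sym[OF G] adj_nonneg])
  fix m x
  assume x: "\<And>i. i < n \<Longrightarrow> x i \<ge> 0" "dot n x x = 1"
    "\<And>i. i < n \<Longrightarrow> matvec n (adj E) x i = m * x i"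
    "\<And>z. dot n z (matvec n (adj E) z) \<le> m * dot n z z"
  have "lam n E = m" by (rule lam_eqI[OF n x])
  with x show thesis by (intro that[of x]) auto
qed

subsection \<open>The resolvent of the complement\<close>

text \<open>The matrix \<open>J - A\<close>: for a graph the diagonal entries are 1, so the
  complement carries a loop at every vertex and \<open>codeg\<close> counts the vertex itself. In
  the Turan graph \<open>codeg\<close> is thus the size of the part.\<close>

definition coadj :: "(nat \<Rightarrow> nat \<Rightarrow> bool) \<Rightarrow> nat \<Rightarrow> nat \<Rightarrow> real" where
  "coadj E i j = of_bool (\<not> E i j)"

definition codeg :: "nat \<Rightarrow> (nat \<Rightarrow> nat \<Rightarrow> bool) \<Rightarrow> nat \<Rightarrow> nat" where
  "codeg n E i = card {j\<in>{..<n}. \<not> E i j}"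

definition resolvent_sol :: "nat \<Rightarrow> (nat \<Rightarrow> nat \<Rightarrow> bool) \<Rightarrow> real \<Rightarrow> (nat \<Rightarrow> real) \<Rightarrow> bool" where
  "resolvent_sol n E t y \<longleftrightarrow> (\<forall>i<n. t * y i + matvec n (coadj E) y i = 1)"

lemma coadj_sym: "is_graph n E \<Longrightarrow> coadj E i j = coadj E j i"
  by (auto simp: coadj_def is_graph_def)

lemma sum_coadj: "(\<Sum>j<n. coadj E i j) = real (codeg n E i)"
  by (simp add: coadj_def codeg_def of_bool_def sum.If_cases Int_def)

lemma codeg_pos: "is_graph n E \<Longrightarrow> i < n \<Longrightarrow> codeg n E i \<ge> 1"
proof -
  assume "is_graph n E" "i < n"
  then have "card {i} \<le> codeg n E i"
    unfolding codeg_def by (intro card_mono) (auto simp: is_graph_def)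
  then show ?thesis by simp
qed

lemma matvec_coadj: "matvec n (coadj E) x i = sum x {..<n} - matvec n (adj E) x i"
  by (simp add: matvec_def coadj_def adj_def of_bool_def sum_subtractf[symmetric] cong: if_cong)
    (auto intro!: sum.cong)

lemma dot_matvec_coadj: "dot n x (matvec n (coadj E) x) = (sum x {..<n})\<^sup>2 - dot n x (matvec n (adj E) x)"
  by (simp add: dot_def matvec_coadj algebra_simps sum_subtractf power2_eq_square sum_distrib_left)

lemma lam_nonneg:
  assumes "n \<ge> 1" "is_graph n E"
  shows "lam n E \<ge> 0"
proof (rule lam_perron[OF assms])
  fix x
  assume x: "\<And>i. i < n \<Longrightarrow> x i \<ge> 0" "dot n x x = 1"
    "\<And>z. dot n z (matvec n (adj E) z) \<le> lam n E * dot n z z"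
  have "0 \<le> dot n x (matvec n (adj E) x)"
    unfolding dot_matvec using x(1) adj_nonneg by (intro sum_nonneg) auto
  with x(2) x(3)[of x] show ?thesis by simp
qed

lemma rayleigh_le:
  assumes "n \<ge> 1" "is_graph n E"
  shows "dot n z (matvec n (adj E) z) \<le> lam n E * dot n z z"
  by (rule lam_perron[OF assms]) blast

text \<open>Since \<open>B = J - A\<close>, the form of \<open>B\<close> at \<open>z\<close> is a
  square minus the form of \<open>A\<close>, hence at least \<open>- lam n E * dot n z z\<close>. So
  \<open>t + B\<close> is positive definite beyond \<open>lam n E\<close>.\<close>

lemma coercive:
  assumes "n \<ge> 1" "is_graph n E"
  shows "(t - lam n E) * dot n z z \<le> t * dot n z z + dot n z (matvec n (coadj E) z)"
  using rayleigh_le[OF assms, of z] zero_le_power2[of "sum z {..<n}"]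
  unfolding dot_matvec_coadj left_diff_distrib by linarith

text \<open>Coercivity makes \<open>t + B\<close> injective, and an injective square matrix is
  invertible.\<close>

lemma ex_resolvent_sol:
  assumes n: "n \<ge> 1" and G: "is_graph n E" and t: "t > lam n E"
  shows "\<exists>y. resolvent_sol n E t y"
proof -
  define M where "M = mat n n (\<lambda>(i,j). (if i = j then t else 0) + coadj E i j)"
  have M: "M \<in> carrier_mat n n" by (simp add: M_def)
  have app: "(M *\<^sub>v v) $ i = t * v $ i + matvec n (coadj E) (\<lambda>j. v $ j) i"
    if "v \<in> carrier_vec n" "i < n" for v i
  proof -
    have "(M *\<^sub>v v) $ i = (\<Sum>j<n. ((if i = j then t else 0) + coadj E i j) * v $ j)"
      using that by (auto simp: M_def scalar_prod_def lessThan_atLeast0 intro!: sum.cong)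
    also have "\<dots> = (\<Sum>j<n. if i = j then t * v $ j else 0) + matvec n (coadj E) (\<lambda>j. v $ j) i"
      unfolding matvec_def sum.distrib[symmetric] by (intro sum.cong) (auto simp: algebra_simps)
    finally show ?thesis using that by simp
  qed
  have "det M \<noteq> 0"
  proof
    assume "det M = 0"
    then obtain v where v: "v \<in> carrier_vec n" "v \<noteq> 0\<^sub>v n" "M *\<^sub>v v = 0\<^sub>v n"
      using det_0_iff_vec_prod_zero_field[OF M] by auto
    define z where "z i = v $ i" for i
    obtain i0 where "i0 < n" "z i0 \<noteq> 0"
      using v(1,2) by (auto simp: z_def vec_eq_iff)
    then have pos: "dot n z z > 0" by (rule dot_self_pos)
    have "t * z i + matvec n (coadj E) z i = 0" if "i < n" for i
      using app[OF v(1) that] v(3) that by (simp add: z_def[abs_def])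
    then have "dot n z (\<lambda>i. t * z i + matvec n (coadj E) z i) = dot n z (\<lambda>i. 0)"
      by (intro dot_cong) auto
    then have "t * dot n z z + dot n z (matvec n (coadj E) z) = 0"
      by (simp add: dot_add_right dot_scale_right) (simp add: dot_def)
    with coercive[OF n G, of t z] have "(t - lam n E) * dot n z z \<le> 0" by simp
    with pos t show False by (simp add: mult_le_0_iff)
  qed
  then obtain N where N: "N \<in> carrier_mat n n" "M * N = 1\<^sub>m n"
    using det_non_zero_imp_unit[OF M, of "()"] by (auto simp: Units_def ring_mat_def)
  define w where "w = N *\<^sub>v vec n (\<lambda>_. 1)"
  have w: "w \<in> carrier_vec n" using N by (simp add: w_def)
  have "M *\<^sub>v w = (M * N) *\<^sub>v vec n (\<lambda>_. 1)"
    unfolding w_def using M N by (subst assoc_mult_mat_vec) auto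
  then have "M *\<^sub>v w = vec n (\<lambda>_. 1)" using N by simp
  then have "resolvent_sol n E t (\<lambda>j. w $ j)"
    using app[OF w] by (auto simp: resolvent_sol_def)
  then show ?thesis by blast
qed

lemma resolvent_sol_dot:
  assumes "resolvent_sol n E t y"
  shows "t * dot n z y + dot n z (matvec n (coadj E) y) = sum z {..<n}"
proof -
  have "dot n z (\<lambda>i. t * y i + matvec n (coadj E) y i) = dot n z (\<lambda>i. 1)"
    using assms by (intro dot_cong) (auto simp: resolvent_sol_def)
  then show ?thesis by (simp add: dot_add_right dot_scale_right) (simp add: dot_def)
qed

text \<open>The resolvent identity, from pairing each equation with the other solution. For
  \<open>t = t'\<close> it says that the sum does not depend on the chosen solution; for
  \<open>t'\<close> tending to \<open>t\<close> it gives the derivative.\<close>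

lemma resolvent_sol_difference:
  assumes G: "is_graph n E" and y: "resolvent_sol n E t y" "resolvent_sol n E t' y'"
  shows "sum y' {..<n} - sum y {..<n} = (t - t') * dot n y y'"
proof -
  have "dot n y (matvec n (coadj E) y') = dot n y' (matvec n (coadj E) y)"
    by (metis dot_matvec_sym[of "coadj E", OF coadj_sym[OF G]] dot_commute)
  then show ?thesis
    using resolvent_sol_dot[OF y(1), of y'] resolvent_sol_dot[OF y(2), of y] by (simp add: dot_commute[of n y'] algebra_simps)
qed

text \<open>Pairing the equation with \<open>y\<close> itself and writing \<open>B = J - A\<close>
  gives \<open>t |y|^2 - y^T A y = ?s * (1 - ?s)\<close>. The left side is positive because
  \<open>t\<close> exceeds \<open>lam n E\<close> and \<open>y\<close> is nonzero, so
  \<open>?s\<close> lies strictly between 0 and 1.\<close>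

lemma sum_resolvent_sol_less_1:
  assumes n: "n \<ge> 1" and G: "is_graph n E" and t: "t > lam n E" and y: "resolvent_sol n E t y"
  shows "sum y {..<n} < 1"
proof -
  let ?s = "sum y {..<n}"
  have "y 0 \<noteq> 0 \<or> (\<exists>i<n. y i \<noteq> 0)"
  proof (rule ccontr)
    assume "\<not> ?thesis"
    then have "\<forall>i<n. y i = 0" by blast
    then have "matvec n (coadj E) y 0 = 0" by (simp add: matvec_def)
    with y n \<open>\<not> ?thesis\<close> show False by (force simp: resolvent_sol_def)
  qed
  then have "dot n y y > 0" using dot_self_pos n by (metis less_one linorder_not_less not_gr_zero)
  then have "0 < (t - lam n E) * dot n y y" using t by simp
  also have "\<dots> = t * dot n y y - lam n E * dot n y y" by (simp add: algebra_simps)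
  also have "\<dots> \<le> t * dot n y y - dot n y (matvec n (adj E) y)" using rayleigh_le[OF n G, of y] by simp
  also have "\<dots> = ?s * (1 - ?s)"
    using resolvent_sol_dot[OF y, of y] by (simp add: dot_matvec_coadj algebra_simps power2_eq_square)
  finally show ?thesis by (auto simp: zero_less_mult_iff)
qed

section \<open>Laplacian estimates for the complement\<close>

lemma sum_diff_sq:
  fixes y :: "nat \<Rightarrow> real"
  assumes sym: "\<And>i j. C i j = C j i"
  shows "(\<Sum>i<n. y i * (\<Sum>j<n. C i j * (y i - y j))) = (\<Sum>i<n. \<Sum>j<n. C i j * (y i - y j)\<^sup>2) / (2::real)"
proof -
  let ?S = "\<Sum>i<n. y i * (\<Sum>j<n. C i j * (y i - y j))"
  have 1: "?S = (\<Sum>i<n. \<Sum>j<n. y i * (C i j * (y i - y j)))"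
    by (simp add: sum_distrib_left)
  also have "\<dots> = (\<Sum>j<n. \<Sum>i<n. y i * (C i j * (y i - y j)))" by (rule sum.swap)
  also have "\<dots> = (\<Sum>i<n. \<Sum>j<n. y j * (C i j * (y j - y i)))"
    using sym by (intro sum.cong refl) metis
  finally have 2: "?S = (\<Sum>i<n. \<Sum>j<n. y j * (C i j * (y j - y i)))" .
  have "?S + ?S = (\<Sum>i<n. \<Sum>j<n. C i j * (y i - y j)\<^sup>2)"
    by (subst (2) 2, subst 1, unfold sum.distrib[symmetric])
      (intro sum.cong refl, simp add: algebra_simps power2_eq_square)
  then show ?thesis by simp
qed

lemma sum_diff:
  fixes y :: "nat \<Rightarrow> real"
  assumes sym: "\<And>i j. C i j = C j i"
  shows "(\<Sum>i<n. \<Sum>j<n. C i j * (y i - y j)) = (0::real)"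
proof -
  have "(\<Sum>i<n. \<Sum>j<n. C i j * (y i - y j)) = (\<Sum>j<n. \<Sum>i<n. C i j * (y i - y j))" by (rule sum.swap)
  also have "\<dots> = (\<Sum>i<n. \<Sum>j<n. - (C i j * (y i - y j)))"
    using sym by (intro sum.cong refl) (metis minus_diff_eq mult_minus_right)
  also have "\<dots> = - (\<Sum>i<n. \<Sum>j<n. C i j * (y i - y j))" by (simp add: sum_negf)
  finally show ?thesis by simp
qed

text \<open>Cauchy-Schwarz over the indices other than \<open>i\<close>. Dropping the vanishing
  diagonal term is what gives the factor \<open>n - 1\<close> instead of \<open>n\<close>.\<close>

lemma coadj_diff_sq_le:
  fixes y :: "nat \<Rightarrow> real"
  assumes i: "i < n"
  shows "(\<Sum>j<n. coadj E i j * (y i - y j))\<^sup>2 \<le> (real n - 1) * (\<Sum>j<n. coadj E i j * (y i - y j)\<^sup>2)"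
proof -
  let ?I = "{..<n} - {i}"
  have "(\<Sum>j<n. coadj E i j * (y i - y j)) = (\<Sum>j\<in>?I. coadj E i j * (y i - y j))"
    using i by (intro sum.mono_neutral_right) auto
  then have "(\<Sum>j<n. coadj E i j * (y i - y j))\<^sup>2 = (\<Sum>j\<in>?I. coadj E i j * (y i - y j))\<^sup>2" by simp
  also have "\<dots> \<le> (\<Sum>j\<in>?I. (coadj E i j * (y i - y j))\<^sup>2) * real (card ?I)"
    by (rule sum_squared_le_sum_of_squares)
  also have "(\<Sum>j\<in>?I. (coadj E i j * (y i - y j))\<^sup>2) = (\<Sum>j<n. coadj E i j * (y i - y j)\<^sup>2)"
    using i by (intro sum.mono_neutral_cong_left) (auto simp: coadj_def power_mult_distrib)
  finally show ?thesis using i by (simp add: of_nat_diff mult.commute)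
qed

lemma nat_consecutive_nonneg: "0 \<le> (real k - real a) * (real k - real a - 1)"
proof (cases "k \<le> a")
  case True
  then show ?thesis by (intro mult_nonpos_nonpos) auto
next
  case False
  then have "a + 1 \<le> k" by simp
  then have "real a + 1 \<le> real k" by (metis of_nat_1 of_nat_add of_nat_le_iff)
  then show ?thesis by (intro mult_nonneg_nonneg) auto
qed

text \<open>Here \<open>?W / 2\<close> is \<open>y^T L y\<close>. The coefficient \<open>?c\<close>
  is at least \<open>2n - 1\<close>, while bounding \<open>|L y|^2\<close> costs only
  \<open>2(n - 1)\<close>; the surplus copy of \<open>?W / 2\<close> stays in the bound so that the
  equality case can force \<open>?W = 0\<close>.\<close>

lemma quadratic_lower_bound:
  fixes a n :: nat and t :: real and y :: "nat \<Rightarrow> real"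
  assumes G: "is_graph n E" and y: "resolvent_sol n E t y" and t: "2 * t + 2 * real a + 1 \<ge> 2 * real n - 1"
  shows "(\<Sum>i<n. (real (codeg n E i) - a) * (real (codeg n E i) - a - 1) * (y i)\<^sup>2)
           + (\<Sum>i<n. \<Sum>j<n. coadj E i j * (y i - y j)\<^sup>2) / 2
         \<le> real n - (2 * t + 2 * real a + 1) * sum y {..<n} + (t + a) * (t + a + 1) * dot n y y"
    (is "?U + ?W / 2 \<le> ?R")
proof -
  define k where "k i = real (codeg n E i)" for i
  define l where "l i = (\<Sum>j<n. coadj E i j * (y i - y j))" for i
  let ?c = "2 * t + 2 * real a + 1"
  have l: "l i = (t + k i) * y i - 1" if "i < n" for i
  proof -
    have "l i = k i * y i - matvec n (coadj E) y i"
      by (simp add: l_def k_def matvec_def right_diff_distrib sum_subtractf sum_distrib_right[symmetric] sum_coadj)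
    moreover have "t * y i + matvec n (coadj E) y i = 1" using y that by (simp add: resolvent_sol_def)
    ultimately show ?thesis unfolding distrib_right by linarith
  qed
  have "?R = (\<Sum>i<n. (1 - (t + a) * y i) * (1 - (t + a + 1) * y i))"
    by (simp add: dot_def algebra_simps sum.distrib sum_subtractf sum_distrib_left sum_distrib_right)
  \<comment> \<open>With \<open>u = k i - a\<close>, the formula for \<open>l i\<close> turns the
    two factors into \<open>u * y i - l i\<close> and \<open>(u - 1) * y i - l i\<close>. After
    expanding, \<open>(l i)\<^sup>2\<close> is rewritten as
    \<open>2 * (l i)\<^sup>2 - (l i)\<^sup>2\<close>, and one more use of the formula in the doubled
    term cancels \<open>k i\<close> from the coefficient of \<open>y i * l i\<close>.\<close>
  also have "\<dots> = (\<Sum>i<n. (k i - a) * (k i - a - 1) * (y i)\<^sup>2 + ?c * (y i * l i) - 2 * l i - (l i)\<^sup>2)"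
    by (intro sum.cong refl) (simp add: l algebra_simps power2_eq_square)
  also have "\<dots> = ?U + ?c * (\<Sum>i<n. y i * l i) - 2 * (\<Sum>i<n. l i) - (\<Sum>i<n. (l i)\<^sup>2)"
    by (simp add: sum.distrib sum_subtractf sum_distrib_left k_def)
  also have "(\<Sum>i<n. l i) = 0"
    unfolding l_def by (rule sum_diff) (rule coadj_sym[OF G])
  also have "(\<Sum>i<n. y i * l i) = ?W / 2"
    unfolding l_def by (rule sum_diff_sq) (rule coadj_sym[OF G])
  finally have R: "?R = ?U + ?c * (?W / 2) - (\<Sum>i<n. (l i)\<^sup>2)" by simp
  have "(\<Sum>i<n. (l i)\<^sup>2) \<le> (\<Sum>i<n. (real n - 1) * (\<Sum>j<n. coadj E i j * (y i - y j)\<^sup>2))"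
    unfolding l_def by (intro sum_mono coadj_diff_sq_le) auto
  also have "\<dots> = (real n - 1) * ?W" by (simp add: sum_distrib_left)
  finally have 1: "(\<Sum>i<n. (l i)\<^sup>2) \<le> (real n - 1) * ?W" .
  have W: "0 \<le> ?W" by (intro sum_nonneg) (auto simp: coadj_def)
  have "(2 * real n - 1) * (?W / 2) \<le> ?c * (?W / 2)"
    by (rule mult_right_mono) (use t W in auto)
  moreover have "(2 * real n - 1) * (?W / 2) = (real n - 1) * ?W + ?W / 2"
    by (simp add: field_simps)
  ultimately show ?thesis using 1 R by linarith
qed

lemma sum_nonneg_0_imp:
  fixes x :: "nat \<Rightarrow> real"
  assumes "\<And>i. i < n \<Longrightarrow> x i \<ge> 0" "sum x {..<n} = 0" "i < n"
  shows "x i = 0"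
  using assms sum_nonneg_eq_0_iff[of "{..<n}" x] by auto

lemma sum_pos_if_dot_self:
  assumes x: "\<And>i. i < n \<Longrightarrow> x i \<ge> 0" and d: "dot n x x = 1"
  shows "sum x {..<n} > 0"
proof -
  have "sum x {..<n} \<noteq> 0"
  proof
    assume s: "sum x {..<n} = 0"
    have "x i = 0" if "i < n" for i using x s that by (rule sum_nonneg_0_imp)
    then show False using d by (simp add: dot_def)
  qed
  moreover have "sum x {..<n} \<ge> 0" using x by (intro sum_nonneg) auto
  ultimately show ?thesis by simp
qed

section \<open>Differentiability of the resolvent sum\<close>

text \<open>The difference \<open>d\<close> of two solutions solves
  \<open>(u + B) d = - (u - t) Y t\<close>. Coercivity bounds \<open>c |d|^2\<close> by
  \<open>\<bar>u - t\<bar>\<close> times an inner product; splitting that product into squares lets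
  \<open>|d|^2\<close> be absorbed on the left. The resulting bound on \<open>|d|^2\<close> is
  linear in \<open>\<bar>u - t\<bar>\<close>, which suffices for continuity.\<close>

lemma resolvent_sol_tendsto:
  assumes n: "n \<ge> 1" and G: "is_graph n E" and t: "t > lam n E"
    and Y: "\<And>u. u > lam n E \<Longrightarrow> resolvent_sol n E u (Y u)" and i: "i < n"
  shows "((\<lambda>u. Y u i) \<longlongrightarrow> Y t i) (at t)"
proof -
  \<comment> \<open>Half the distance to \<open>lam n E\<close>: for \<open>u\<close> within
    \<open>c\<close> of \<open>t\<close>, the coercivity constant at \<open>u\<close> is still at
    least \<open>c\<close>.\<close>
  define c where "c = (t - lam n E) / 2"
  define q where "q = dot n (Y t) (Y t)"
  have c: "c > 0" using t by (simp add: c_def)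
  have bound: "(Y u i - Y t i)\<^sup>2 \<le> \<bar>u - t\<bar> * q / c" if u: "\<bar>u - t\<bar> < c" for u
  proof -
    define d where "d j = Y u j + (- 1) * Y t j" for j
    have ut: "u > lam n E" "u - lam n E \<ge> c" using u c by (auto simp: c_def field_simps abs_if split: if_splits)
    have "u * d j + matvec n (coadj E) d j = - (u - t) * Y t j" if "j < n" for j
    proof -
      have "u * Y u j + matvec n (coadj E) (Y u) j = 1" "t * Y t j + matvec n (coadj E) (Y t) j = 1"
        using Y[OF ut(1)] Y[OF t] that by (auto simp: resolvent_sol_def)
      then show ?thesis unfolding d_def[abs_def] matvec_add matvec_scale by (simp add: algebra_simps)
    qed
    then have "dot n d (\<lambda>j. u * d j + matvec n (coadj E) d j) = dot n d (\<lambda>j. - (u - t) * Y t j)"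
      by (intro dot_cong) auto
    then have "u * dot n d d + dot n d (matvec n (coadj E) d) = - (u - t) * dot n d (Y t)"
      unfolding dot_add_right dot_scale_right .
    moreover have "c * dot n d d \<le> (u - lam n E) * dot n d d"
      using ut dot_self_nonneg by (intro mult_right_mono) auto
    ultimately have 1: "c * dot n d d \<le> (t - u) * dot n d (Y t)"
      using coercive[OF n G, of u d] by (simp only: minus_diff_eq)
    have "0 \<le> dot n (\<lambda>j. d j + s * Y t j) (\<lambda>j. d j + s * Y t j)" for s by (rule dot_self_nonneg)
    then have "0 \<le> dot n d d + 2 * s * dot n d (Y t) + s\<^sup>2 * q" for s
      unfolding dot_add_right dot_add_left dot_scale_right dot_scale_left q_def
      by (simp add: dot_commute[of n "Y t" d] algebra_simps power2_eq_square)
    \<comment> \<open>The two signs of \<open>s\<close> together bound the absolute value of the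
      inner product.\<close>
    from this[of 1] this[of "-1"] have 2: "2 * \<bar>dot n d (Y t)\<bar> \<le> dot n d d + q" by auto
    have "(t - u) * dot n d (Y t) \<le> \<bar>t - u\<bar> * \<bar>dot n d (Y t)\<bar>"
      unfolding abs_mult[symmetric] by (rule abs_ge_self)
    moreover have "\<bar>t - u\<bar> * (2 * \<bar>dot n d (Y t)\<bar>) \<le> \<bar>t - u\<bar> * (dot n d d + q)"
      using 2 by (intro mult_left_mono) auto
    moreover have "\<bar>t - u\<bar> * (2 * \<bar>dot n d (Y t)\<bar>) = 2 * (\<bar>t - u\<bar> * \<bar>dot n d (Y t)\<bar>)"
      by (rule mult.left_commute)
    moreover have "\<bar>t - u\<bar> * dot n d d \<le> c * dot n d d"
      using u dot_self_nonneg by (intro mult_right_mono) auto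
    ultimately have "c * dot n d d \<le> \<bar>t - u\<bar> * q"
      using 1 unfolding distrib_left by linarith
    then have "c * dot n d d \<le> \<bar>u - t\<bar> * q" by (simp only: abs_minus_commute)
    moreover have "(d i)\<^sup>2 \<le> dot n d d"
      unfolding dot_def power2_eq_square[symmetric] using i by (intro member_le_sum) auto
    then have "c * (d i)\<^sup>2 \<le> c * dot n d d" using c by simp
    ultimately have "c * (d i)\<^sup>2 \<le> \<bar>u - t\<bar> * q" by linarith
    then show ?thesis using c by (simp add: d_def pos_le_divide_eq mult.commute)
  qed
  have "((\<lambda>u. \<bar>u - t\<bar> * q / c) \<longlongrightarrow> \<bar>t - t\<bar> * q / c) (at t)"
    using c by (intro tendsto_intros) auto
  then have lim: "((\<lambda>u. \<bar>u - t\<bar> * q / c) \<longlongrightarrow> 0) (at t)" by simp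
  have "((\<lambda>u. (Y u i - Y t i)\<^sup>2) \<longlongrightarrow> 0) (at t)"
  proof (rule tendsto_sandwich[OF _ _ tendsto_const lim])
    show "\<forall>\<^sub>F u in at t. (Y u i - Y t i)\<^sup>2 \<le> \<bar>u - t\<bar> * q / c"
      unfolding eventually_at using c bound by (auto simp: dist_real_def)
  qed auto
  then have "((\<lambda>u. sqrt ((Y u i - Y t i)\<^sup>2)) \<longlongrightarrow> sqrt 0) (at t)" by (rule tendsto_real_sqrt)
  then have "((\<lambda>u. Y u i - Y t i) \<longlongrightarrow> 0) (at t)" by (simp add: tendsto_rabs_zero_iff)
  then show ?thesis by (simp add: LIM_zero_iff)
qed

text \<open>By the resolvent identity the difference quotient is exactly
  \<open>- dot n (Y t) (Y u)\<close>, so continuity of the solution is all that remains.\<close>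

lemma sum_resolvent_sol_has_derivative:
  assumes n: "n \<ge> 1" and G: "is_graph n E" and t: "t > lam n E"
    and Y: "\<And>u. u > lam n E \<Longrightarrow> resolvent_sol n E u (Y u)"
  shows "((\<lambda>u. sum (Y u) {..<n}) has_real_derivative - dot n (Y t) (Y t)) (at t)"
  unfolding has_field_derivative_iff
proof (rule Lim_transform_eventually)
  show "((\<lambda>u. - dot n (Y t) (Y u)) \<longlongrightarrow> - dot n (Y t) (Y t)) (at t)"
    unfolding dot_def by (intro tendsto_intros resolvent_sol_tendsto[OF n G t Y]) auto
  have "- dot n (Y t) (Y u) = (sum (Y u) {..<n} - sum (Y t) {..<n}) / (u - t)"
    if "u \<noteq> t" "dist u t < t - lam n E" for u
  proof -
    have "u > lam n E" using that by (auto simp: dist_real_def abs_if split: if_splits)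
    then have "sum (Y u) {..<n} - sum (Y t) {..<n} = (t - u) * dot n (Y t) (Y u)"
      by (intro resolvent_sol_difference[OF G Y[OF t] Y])
    then show ?thesis using that by (simp add: field_simps)
  qed
  then show "\<forall>\<^sub>F u in at t. - dot n (Y t) (Y u) = (sum (Y u) {..<n} - sum (Y t) {..<n}) / (u - t)"
    unfolding eventually_at using t by (intro exI[of _ "t - lam n E"]) auto
qed

subsection \<open>Balanced complements\<close>

text \<open>The equality case of the derivative estimate: \<open>u_i (u_i - 1) = 0\<close> at every
  vertex, and codegree constant on components of the complement.\<close>

definition balanced :: "nat \<Rightarrow> nat \<Rightarrow> (nat \<Rightarrow> nat \<Rightarrow> bool) \<Rightarrow> bool" where
  "balanced n a E \<longleftrightarrow> (\<forall>i<n. codeg n E i = a \<or> codeg n E i = a + 1) \<and>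
     (\<forall>i<n. \<forall>j<n. \<not> E i j \<longrightarrow> codeg n E i = codeg n E j)"

definition top_codeg :: "nat \<Rightarrow> nat \<Rightarrow> (nat \<Rightarrow> nat \<Rightarrow> bool) \<Rightarrow> nat set" where
  "top_codeg n a E = {i\<in>{..<n}. codeg n E i = a + 1}"

text \<open>Codegree is constant along complement edges, so \<open>B\<close> acts on functions of
  the codegree as multiplication by it. Codegrees are at least 1, so the denominators are positive
  even at \<open>t = 0\<close>.\<close>

lemma balanced_resolvent_sol:
  fixes t :: real
  assumes G: "is_graph n E" and b: "balanced n a E" and t: "t \<ge> 0"
  shows "resolvent_sol n E t (\<lambda>i. 1 / (t + codeg n E i))"
  unfolding resolvent_sol_def
proof (intro allI impI)
  fix i assume i: "i < n"
  have "matvec n (coadj E) (\<lambda>i. 1 / (t + codeg n E i)) i = (\<Sum>j<n. coadj E i j * (1 / (t + codeg n E i)))"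
    unfolding matvec_def
  proof (rule sum.cong[OF refl])
    fix j assume "j \<in> {..<n}"
    then show "coadj E i j * (1 / (t + codeg n E j)) = coadj E i j * (1 / (t + codeg n E i))"
      using b i unfolding balanced_def by (cases "E i j") (simp_all add: coadj_def)
  qed
  also have "\<dots> = codeg n E i / (t + codeg n E i)"
    by (simp add: sum_distrib_right[symmetric] sum_divide_distrib[symmetric] sum_coadj)
  finally show "t * (1 / (t + codeg n E i)) + matvec n (coadj E) (\<lambda>i. 1 / (t + codeg n E i)) i = 1"
    using codeg_pos[OF G i] t by (simp add: add_divide_distrib[symmetric])
qed

text \<open>The prefactor clears both possible denominators, leaving \<open>t + a + 1\<close> or
  \<open>t + a\<close> per vertex. The result is affine in \<open>t\<close> with slope
  \<open>n\<close>, which makes \<open>height\<close> constant, and its value reveals the number of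
  vertices of codegree \<open>a + 1\<close>.\<close>

lemma balanced_sum:
  fixes t :: real
  assumes G: "is_graph n E" and b: "balanced n a E" and t: "t \<ge> 0"
  shows "(t + a) * (t + a + 1) * (\<Sum>i<n. 1 / (t + codeg n E i)) = n * t + n * a + n - card (top_codeg n a E)"
proof -
  have "(t + a) * (t + a + 1) * (\<Sum>i<n. 1 / (t + codeg n E i)) =
      (\<Sum>i<n. (t + a + 1) - of_bool (codeg n E i = a + 1))"
    unfolding sum_distrib_left
  proof (rule sum.cong[OF refl])
    fix i assume "i \<in> {..<n}"
    then have i: "i < n" by simp
    then have k: "codeg n E i = a \<or> codeg n E i = a + 1" using b by (auto simp: balanced_def)
    have "t + codeg n E i > 0" using codeg_pos[OF G i] t by (intro add_nonneg_pos) auto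
    with k show "(t + a) * (t + a + 1) * (1 / (t + codeg n E i)) = (t + a + 1) - of_bool (codeg n E i = a + 1)"
      by (elim disjE) (simp_all add: field_simps)
  qed
  also have "\<dots> = n * (t + a + 1) - card (top_codeg n a E)"
    by (simp add: sum_subtractf top_codeg_def of_bool_def sum.If_cases Int_def)
  finally show ?thesis by (simp add: algebra_simps)
qed

text \<open>The explicit solution persists at \<open>t = lam n E\<close>. Pairing its equation with
  a Perron vector \<open>x\<close>, for which \<open>B x = (sum x) 1 - lam x\<close>, leaves
  \<open>sum x * sum y = sum x\<close> with \<open>sum x > 0\<close>.\<close>

lemma balanced_sum_lam:
  assumes n: "n \<ge> 1" and G: "is_graph n E" and b: "balanced n a E"
  shows "(\<Sum>i<n. 1 / (lam n E + codeg n E i)) = 1"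
proof (rule lam_perron[OF n G])
  fix x
  assume x: "\<And>i. i < n \<Longrightarrow> x i \<ge> 0" "dot n x x = 1"
    "\<And>i. i < n \<Longrightarrow> matvec n (adj E) x i = lam n E * x i"
  let ?y = "\<lambda>i. 1 / (lam n E + codeg n E i)"
  have "matvec n (coadj E) x i = sum x {..<n} - lam n E * x i" if "i < n" for i
    using x(3)[OF that] by (simp add: matvec_coadj)
  then have "dot n ?y (matvec n (coadj E) x) = dot n ?y (\<lambda>i. sum x {..<n} * 1 + (- lam n E) * x i)"
    by (intro dot_cong) auto
  then have "dot n ?y (matvec n (coadj E) x) = sum x {..<n} * sum ?y {..<n} - lam n E * dot n ?y x"
    unfolding dot_add_right dot_scale_right by (simp add: dot_def)
  moreover have "lam n E * dot n x ?y + dot n x (matvec n (coadj E) ?y) = sum x {..<n}"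
    by (rule resolvent_sol_dot[OF balanced_resolvent_sol[OF G b lam_nonneg[OF n G]]])
  moreover have "dot n x (matvec n (coadj E) ?y) = dot n ?y (matvec n (coadj E) x)"
    by (metis dot_matvec_sym[of "coadj E", OF coadj_sym[OF G]] dot_commute)
  ultimately have "sum x {..<n} * sum ?y {..<n} = sum x {..<n}"
    by (simp add: dot_commute[of n x])
  then show ?thesis using sum_pos_if_dot_self[OF x(1,2)] by simp
qed

subsection \<open>Joins with an edgeless graph\<close>

text \<open>Split the Perron vector of the join into its top part, with sum \<open>T\<close>, and
  its bottom part \<open>x\<close>, with sum \<open>S\<close>. The bottom rows say
  \<open>(\<rho> + B) x = (S + T) 1\<close>, so \<open>x / (S + T)\<close> solves the resolvent
  equation; the top rows give \<open>\<rho> * T = s * S\<close> and hence the value of the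
  sum.\<close>

lemma join_resolvent_sol:
  assumes n: "n \<ge> 1" and s: "s \<ge> 1" and G: "is_graph n E"
  defines "\<rho> \<equiv> lam (s + n) (join_empty s n E)"
  shows "\<rho> > lam n E" "\<exists>y. resolvent_sol n E \<rho> y \<and> sum y {..<n} = \<rho> / (\<rho> + s)"
proof -
  let ?J = "join_empty s n E"
  have J: "is_graph (s + n) ?J"
    unfolding is_graph_def
  proof (intro allI impI)
    fix i j assume "?J i j"
    moreover have "i < s + n \<and> j < s + n \<and> i \<noteq> j \<and> E (j - s) (i - s)"
      if "s \<le> i" "s \<le> j" "E (i - s) (j - s)"
    proof -
      have "i - s < n" "j - s < n" "i - s \<noteq> j - s" "E (j - s) (i - s)"
        using G that(3) by (auto simp: is_graph_def)
      with that show ?thesis by linarith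
    qed
    ultimately show "i < s + n \<and> j < s + n \<and> i \<noteq> j \<and> ?J j i"
      by (auto simp: join_empty_def)
  qed
  have sn: "s + n \<ge> 1" using n by simp
  obtain z where z0: "\<And>i. i < s + n \<Longrightarrow> z i \<ge> 0" and z1: "dot (s + n) z z = 1"
    and z: "\<And>i. i < s + n \<Longrightarrow> matvec (s + n) (adj ?J) z i = \<rho> * z i"
    by (rule lam_perron[OF sn J, folded \<rho>_def]) (rule that)
  have split: "(\<Sum>i<s + n. f i) = (\<Sum>i<s. f i) + (\<Sum>i<n. f (s + i))" for f :: "nat \<Rightarrow> real"
    by (simp add: sum.nat_group lessThan_atLeast0 sum.atLeastLessThan_concat[symmetric, of 0 s "s + n"]
        sum.shift_bounds_nat_ivl[of f 0 s n, simplified, unfolded add.commute[of _ s]])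
  define x where "x j = z (s + j)" for j
  define S where "S = sum x {..<n}"
  define T where "T = sum z {..<s}"
  have \<rho>0: "\<rho> \<ge> 0" unfolding \<rho>_def by (rule lam_nonneg[OF sn J])
  have x0: "x j \<ge> 0" if "j < n" for j using z0 that by (simp add: x_def)
  have ST: "S \<ge> 0" "T \<ge> 0" using x0 z0 by (auto simp: S_def T_def intro!: sum_nonneg)
  have top: "\<rho> * z i = S" if "i < s" for i
  proof -
    have "\<rho> * z i = matvec (s + n) (adj ?J) z i" using z[of i] that by simp
    also have "\<dots> = S"
      using that by (simp add: matvec_def split adj_def join_empty_def S_def x_def)
    finally show ?thesis .
  qed
  have bot: "\<rho> * x j = T + matvec n (adj E) x j" if "j < n" for j
  proof -
    have "\<rho> * x j = matvec (s + n) (adj ?J) z (s + j)" using z[of "s + j"] that by (simp add: x_def)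
    also have "\<dots> = T + matvec n (adj E) x j"
      using that by (simp add: matvec_def split adj_def join_empty_def T_def x_def)
    finally show ?thesis .
  qed
  have \<rho>T: "\<rho> * T = s * S"
    by (simp add: T_def sum_distrib_left top)
  have "T \<noteq> 0 \<or> S \<noteq> 0"
  proof (rule ccontr)
    assume 0: "\<not> ?thesis"
    then have "z i = 0" if "i < s" for i
      using that z0 by (intro sum_nonneg_0_imp[of s z]) (auto simp: T_def)
    moreover have "x i = 0" if "i < n" for i
      using that x0 0 by (intro sum_nonneg_0_imp[of n x]) (auto simp: S_def)
    ultimately have "dot (s + n) z z = 0" by (simp add: dot_def split x_def)
    with z1 show False by simp
  qed
  \<comment> \<open>If \<open>S = 0\<close> then \<open>x\<close> vanishes at 0, and row 0 of
    \<open>bot\<close> writes 0 as \<open>T\<close> plus a nonnegative term.\<close>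
  moreover have "S = 0 \<longrightarrow> T = 0"
  proof
    assume "S = 0"
    then have "x 0 = 0" using x0 n by (intro sum_nonneg_0_imp[of n x]) (auto simp: S_def)
    moreover have "matvec n (adj E) x 0 \<ge> 0"
      unfolding matvec_def using x0 adj_nonneg by (intro sum_nonneg) auto
    ultimately show "T = 0" using bot[of 0] n ST by simp
  qed
  ultimately have S: "S > 0" using ST by fastforce
  have "0 < \<rho> * T" using \<rho>T S s by simp
  then have \<rho>: "\<rho> > 0" "T > 0" using \<rho>0 ST by (auto simp: zero_less_mult_iff)
  \<comment> \<open>Pairing \<open>bot\<close> with a Perron vector \<open>p\<close> of the graph
    gives \<open>(\<rho> - lam n E) * dot n p x = T * sum p\<close>, which is positive.\<close>
  show "\<rho> > lam n E"
  proof (rule lam_perron[OF n G])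
    fix p
    assume p: "\<And>i. i < n \<Longrightarrow> p i \<ge> 0" "dot n p p = 1"
      "\<And>i. i < n \<Longrightarrow> matvec n (adj E) p i = lam n E * p i"
    have "dot n p (\<lambda>j. \<rho> * x j) = dot n p (\<lambda>j. T * 1 + matvec n (adj E) x j)"
      using bot by (intro dot_cong) auto
    then have "\<rho> * dot n p x = T * sum p {..<n} + dot n p (matvec n (adj E) x)"
      unfolding dot_add_right dot_scale_right by (simp add: dot_def)
    also have "dot n p (matvec n (adj E) x) = dot n (\<lambda>j. lam n E * p j) x"
      using p(3) by (subst dot_matvec_sym[of "adj E", OF adj_sym[OF G]]) (intro dot_cong, auto)
    finally have 1: "(\<rho> - lam n E) * dot n p x = T * sum p {..<n}"
      unfolding dot_scale_left left_diff_distrib by linarith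
    with sum_pos_if_dot_self[OF p(1,2)] \<rho> have "0 < (\<rho> - lam n E) * dot n p x" by simp
    moreover have "dot n p x \<ge> 0" using p(1) x0 by (auto simp: dot_def intro!: sum_nonneg)
    ultimately show "\<rho> > lam n E" by (auto simp: zero_less_mult_iff)
  qed
  have "resolvent_sol n E \<rho> (\<lambda>j. inverse (S + T) * x j)"
    unfolding resolvent_sol_def matvec_scale
  proof (intro allI impI)
    fix i assume "i < n"
    then have "\<rho> * x i + matvec n (coadj E) x i = S + T" using bot by (simp add: matvec_coadj S_def)
    then have "inverse (S + T) * (\<rho> * x i + matvec n (coadj E) x i) = 1" using S ST by simp
    then show "\<rho> * (inverse (S + T) * x i) + inverse (S + T) * matvec n (coadj E) x i = 1"
      by (simp add: algebra_simps)
  qed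
  moreover have "(\<Sum>j<n. inverse (S + T) * x j) = \<rho> / (\<rho> + s)"
  proof -
    have "(\<Sum>j<n. inverse (S + T) * x j) = S / (S + T)"
      by (simp add: sum_distrib_left[symmetric] S_def divide_inverse)
    also have "\<dots> = \<rho> / (\<rho> + s)"
      using S ST \<rho> \<rho>T by (simp add: frac_eq_eq algebra_simps)
    finally show ?thesis .
  qed
  ultimately show "\<exists>y. resolvent_sol n E \<rho> y \<and> sum y {..<n} = \<rho> / (\<rho> + s)" by blast
qed

subsection \<open>Monotonicity along the resolvent\<close>

text \<open>Every term of the lower bound is nonnegative, so all vanish. Then \<open>y\<close> is
  constant along complement edges, which reduces the equation to \<open>(t + k i) * y i = 1\<close>.
  So \<open>y i\<close> is nonzero, \<open>k i\<close> is \<open>a\<close> or \<open>a + 1\<close>,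
  and equal values of \<open>y\<close> mean equal codegrees.\<close>

lemma zero_excess_imp_balanced:
  fixes a n :: nat and t :: real and y :: "nat \<Rightarrow> real"
  assumes G: "is_graph n E" and y: "resolvent_sol n E t y" and t: "2 * t + 2 * real a + 1 \<ge> 2 * real n - 1"
    and le: "real n - (2 * t + 2 * real a + 1) * sum y {..<n} + (t + a) * (t + a + 1) * dot n y y \<le> 0"
  shows "balanced n a E"
proof -
  define k where "k i = codeg n E i" for i
  let ?u = "\<lambda>i. (real (k i) - a) * (real (k i) - a - 1) * (y i)\<^sup>2"
  let ?w = "\<lambda>i. \<Sum>j<n. coadj E i j * (y i - y j)\<^sup>2"
  have u: "?u i \<ge> 0" for i by (intro mult_nonneg_nonneg nat_consecutive_nonneg) auto
  have w: "?w i \<ge> 0" for i by (intro sum_nonneg) (auto simp: coadj_def)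
  have "(\<Sum>i<n. ?u i) \<ge> 0" "(\<Sum>i<n. ?w i) \<ge> 0" using u by (auto intro!: sum_nonneg simp: coadj_def)
  moreover have "(\<Sum>i<n. ?u i) + (\<Sum>i<n. ?w i) / 2 \<le> 0"
    using quadratic_lower_bound[OF G y t] le unfolding k_def by linarith
  ultimately have "(\<Sum>i<n. ?u i) = 0" "(\<Sum>i<n. ?w i) = 0" by linarith+
  then have u0: "?u i = 0" and w0: "?w i = 0" if "i < n" for i
    using sum_nonneg_eq_0_iff[of "{..<n}" ?u] sum_nonneg_eq_0_iff[of "{..<n}" ?w] that u w by simp_all
  have eq: "y i = y j" if "i < n" "j < n" "\<not> E i j" for i j
  proof -
    have "coadj E i j * (y i - y j)\<^sup>2 = 0"
      using w0[OF that(1)] that(2) by (subst (asm) sum_nonneg_eq_0_iff) (auto simp: coadj_def)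
    then show ?thesis using that by (simp add: coadj_def)
  qed
  have y1: "(t + k i) * y i = 1" if i: "i < n" for i
  proof -
    have "matvec n (coadj E) y i = (\<Sum>j<n. coadj E i j * y i)"
      unfolding matvec_def
    proof (rule sum.cong[OF refl])
      fix j assume "j \<in> {..<n}"
      then show "coadj E i j * y j = coadj E i j * y i"
        using eq[OF i, of j] by (cases "E i j") (simp_all add: coadj_def)
    qed
    also have "\<dots> = k i * y i" by (simp add: sum_distrib_right[symmetric] sum_coadj k_def)
    finally have "matvec n (coadj E) y i = k i * y i" .
    moreover have "t * y i + matvec n (coadj E) y i = 1" using y i by (simp add: resolvent_sol_def)
    ultimately show ?thesis by (simp add: distrib_right)
  qed
  show ?thesis unfolding balanced_def k_def[symmetric]
  proof (intro conjI allI impI)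
    fix i assume i: "i < n"
    then have "y i \<noteq> 0" using y1 by force
    with u0[OF i] have "real (k i) = real a \<or> real (k i) = real (a + 1)" by auto
    then show "k i = a \<or> k i = a + 1" by (simp only: of_nat_eq_iff)
    fix j assume j: "j < n" "\<not> E i j"
    then have "(t + k i) * y i = (t + k j) * y i" using y1[OF i] y1[OF j(1)] eq[OF i j] by simp
    with \<open>y i \<noteq> 0\<close> show "k i = k j" by simp
  qed
qed

definition height :: "nat \<Rightarrow> nat \<Rightarrow> (real \<Rightarrow> nat \<Rightarrow> real) \<Rightarrow> real \<Rightarrow> real" where
  "height n a Y t = (t + a) * (t + a + 1) * sum (Y t) {..<n} - n * t"

definition excess :: "nat \<Rightarrow> nat \<Rightarrow> (real \<Rightarrow> nat \<Rightarrow> real) \<Rightarrow> real \<Rightarrow> real" where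
  "excess n a Y t = real n - (2 * t + 2 * real a + 1) * sum (Y t) {..<n} + (t + a) * (t + a + 1) * dot n (Y t) (Y t)"

lemma height_has_derivative:
  assumes n: "n \<ge> 1" and G: "is_graph n E" and t: "t > lam n E"
    and Y: "\<And>u. u > lam n E \<Longrightarrow> resolvent_sol n E u (Y u)"
  shows "(height n a Y has_real_derivative - excess n a Y t) (at t)"
  unfolding height_def[abs_def] excess_def
  by (rule derivative_eq_intros sum_resolvent_sol_has_derivative[OF n G t Y] refl | assumption)+
    (simp add: algebra_simps)

lemma excess_nonneg:
  assumes G: "is_graph n E" and y: "resolvent_sol n E t (Y t)" and t: "2 * t + 2 * real a + 1 \<ge> 2 * real n - 1"
  shows "excess n a Y t \<ge> 0"
proof -
  have "0 \<le> (\<Sum>i<n. (real (codeg n E i) - a) * (real (codeg n E i) - a - 1) * (Y t i)\<^sup>2)"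
    by (intro sum_nonneg mult_nonneg_nonneg nat_consecutive_nonneg) auto
  moreover have "0 \<le> (\<Sum>i<n. \<Sum>j<n. coadj E i j * (Y t i - Y t j)\<^sup>2)"
    by (intro sum_nonneg) (auto simp: coadj_def)
  ultimately show ?thesis
    using quadratic_lower_bound[OF G y t] unfolding excess_def by linarith
qed

lemma height_antimono:
  assumes n: "n \<ge> 1" and G: "is_graph n E"
    and Y: "\<And>u. u > lam n E \<Longrightarrow> resolvent_sol n E u (Y u)"
    and t: "2 * t + 2 * real a + 1 \<ge> 2 * real n - 1" "t > lam n E" "t \<le> t'"
  shows "height n a Y t' \<le> height n a Y t"
proof (rule DERIV_nonpos_imp_nonincreasing[OF t(3)])
  fix x assume x: "t \<le> x" "x \<le> t'"
  then have lx: "x > lam n E" using t by simp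
  have "excess n a Y x \<ge> 0"
    using x t by (intro excess_nonneg[OF G, of x Y] Y lx) auto
  then show "\<exists>z. (height n a Y has_real_derivative z) (at x) \<and> z \<le> 0"
    using height_has_derivative[OF n G lx Y, of a] by (intro exI[of _ "- excess n a Y x"]) auto
qed

lemma height_less:
  assumes n: "n \<ge> 1" and G: "is_graph n E" and t: "t > lam n E"
    and Y: "\<And>u. u > lam n E \<Longrightarrow> resolvent_sol n E u (Y u)"
  shows "height n a Y t < (t + a) * (t + a + 1) - n * t"
proof -
  have "t > 0" using t lam_nonneg[OF n G] by simp
  then have "0 < (t + a) * (t + a + 1)" by (intro mult_pos_pos) auto
  then have "(t + a) * (t + a + 1) * sum (Y t) {..<n} < (t + a) * (t + a + 1) * 1"
    using sum_resolvent_sol_less_1[OF n G t Y[OF t]] by (intro mult_strict_left_mono)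
  then show ?thesis by (simp add: height_def)
qed

text \<open>The right side is the height that a resolvent sum of 1 would give at \<open>m\<close>.
  Since \<open>m = lam n E\<close> is allowed, where \<open>Y\<close> is unconstrained, the bound is
  taken at \<open>u > m\<close> and passed to the limit from the right.\<close>

lemma height_le_limit:
  assumes n: "n \<ge> 1" and G: "is_graph n E"
    and Y: "\<And>u. u > lam n E \<Longrightarrow> resolvent_sol n E u (Y u)"
    and m: "2 * m + 2 * real a + 1 \<ge> 2 * real n - 1" "m \<ge> lam n E" and t: "t > m"
  shows "height n a Y t \<le> (m + a) * (m + a + 1) - n * m"
proof (rule tendsto_lowerbound)
  show "((\<lambda>u. (u + a) * (u + a + 1) - n * u) \<longlongrightarrow> (m + a) * (m + a + 1) - n * m) (at_right m)"
    by (intro tendsto_intros)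
  have "height n a Y t \<le> (u + a) * (u + a + 1) - n * u" if "m < u" "u < t" for u :: real
  proof -
    have "height n a Y t \<le> height n a Y u"
      using that m by (intro height_antimono[OF n G Y]) auto
    also have "\<dots> \<le> (u + a) * (u + a + 1) - n * u"
      using that m by (intro less_imp_le height_less[OF n G _ Y]) auto
    finally show ?thesis .
  qed
  then show "\<forall>\<^sub>F u in at_right m. height n a Y t \<le> (u + a) * (u + a + 1) - n * u"
    unfolding eventually_at_right_field using t by blast
qed simp

text \<open>Equality at one \<open>t\<close> squeezes the antitone height into being constant on
  \<open>(m, t]\<close>. If \<open>m\<close> exceeded \<open>lam n E\<close>, the strict bound at
  \<open>m\<close> itself would contradict this.\<close>

lemma height_eq_limit:
  assumes n: "n \<ge> 1" and G: "is_graph n E"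
    and Y: "\<And>u. u > lam n E \<Longrightarrow> resolvent_sol n E u (Y u)"
    and m: "2 * m + 2 * real a + 1 \<ge> 2 * real n - 1" "m \<ge> lam n E" and t: "t > m"
    and eq: "height n a Y t = (m + a) * (m + a + 1) - n * m"
  shows "m = lam n E" "balanced n a E"
proof -
  have const: "height n a Y u = height n a Y t" if "m < u" "u \<le> t" for u
  proof (rule antisym)
    show "height n a Y u \<le> height n a Y t"
      unfolding eq using that by (intro height_le_limit[OF n G Y m]) auto
    show "height n a Y t \<le> height n a Y u"
      using that m by (intro height_antimono[OF n G Y]) auto
  qed
  show "m = lam n E"
  proof (rule ccontr)
    assume "m \<noteq> lam n E"
    then have lm: "m > lam n E" using m by simp
    have "height n a Y t \<le> height n a Y m"
      using lm m t by (intro height_antimono[OF n G Y]) auto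
    also have "\<dots> < (m + a) * (m + a + 1) - n * m" by (rule height_less[OF n G lm Y])
    finally show False using eq by simp
  qed
  \<comment> \<open>An interior point, so that the height is constant on a neighbourhood and its
    derivative vanishes there.\<close>
  define u where "u = (m + t) / 2"
  have u: "m < u" "u < t" using t by (auto simp: u_def)
  then have lu: "u > lam n E" using m by simp
  have "\<forall>\<^sub>F v in nhds u. height n a Y v = height n a Y t"
    using eventually_nhds_in_open[of "{m<..<t}" u] u
    by (auto elim!: eventually_mono intro!: const)
  then have "(height n a Y has_real_derivative 0) (at u)"
    by (subst DERIV_cong_ev[OF refl _ refl]) auto
  then have "excess n a Y u = 0"
    using DERIV_unique height_has_derivative[OF n G lu Y] by fastforce
  then show "balanced n a E"
    unfolding excess_def using m u by (intro zero_excess_imp_balanced[OF G Y[OF lu]]) auto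
qed

subsection \<open>Turan graphs\<close>

text \<open>The quotients \<open>q\<close> with \<open>q * r + c < n\<close> are those below
  \<open>n div r\<close>, and \<open>n div r\<close> itself exactly when \<open>c\<close> is below
  the remainder.\<close>

lemma card_residue_class:
  assumes c: "c < (r::nat)"
  shows "card {j\<in>{..<n}. j mod r = c} = n div r + of_bool (c < n mod r)"
proof -
  let ?a = "n div r + of_bool (c < n mod r)"
  have n: "n = n div r * r + n mod r" by simp
  have r: "n mod r < r" using c by simp
  have "{j\<in>{..<n}. j mod r = c} = (\<lambda>q. q * r + c) ` {..<?a}"
  proof (intro equalityI subsetI)
    fix j assume j: "j \<in> {j\<in>{..<n}. j mod r = c}"
    then have jj: "j = j div r * r + c" by auto
    have le: "j div r \<le> n div r" using j by (intro div_le_mono) auto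
    have "j div r < ?a"
    proof (cases "j div r = n div r")
      case True
      then have "c < n mod r" using j jj n by (metis (lifting) lessThan_iff mem_Collect_eq nat_add_left_cancel_less)
      with True show ?thesis by simp
    next
      case False
      with le show ?thesis by simp
    qed
    then show "j \<in> (\<lambda>q. q * r + c) ` {..<?a}" using jj by blast
  next
    fix j assume "j \<in> (\<lambda>q. q * r + c) ` {..<?a}"
    then obtain q where q: "q < ?a" "j = q * r + c" by blast
    have "j < n"
    proof (cases "q < n div r")
      case True
      then have "(q + 1) * r \<le> n div r * r" by (intro mult_right_mono) auto
      then have "(q + 1) * r \<le> n" by (rule order_trans[OF _ div_times_less_eq_dividend])
      then have "q * r + r \<le> n" by simp
      then show ?thesis using q c by linarith
    next
      case False
      then have "q = n div r" "c < n mod r" using q(1) by (auto split: if_splits simp: of_bool_def)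
      then have "j < n div r * r + n mod r" using q(2) by (simp only: add_less_cancel_left)
      then show ?thesis by (simp only: div_mult_mod_eq)
    qed
    with q c show "j \<in> {j\<in>{..<n}. j mod r = c}" by auto
  qed
  moreover have "inj_on (\<lambda>q. q * r + c) {..<?a}" using c by (auto simp: inj_on_def)
  ultimately show ?thesis by (simp add: card_image)
qed

lemma turan_graph: "is_graph n (turan r n)"
  by (auto simp: is_graph_def turan_def)

lemma codeg_turan:
  assumes "r \<ge> 1" "i < n"
  shows "codeg n (turan r n) i = n div r + of_bool (i mod r < n mod r)"
proof -
  have "{j\<in>{..<n}. \<not> turan r n i j} = {j\<in>{..<n}. j mod r = i mod r}"
    using assms by (auto simp: turan_def)
  moreover have "i mod r < r" using assms by simp
  ultimately show ?thesis unfolding codeg_def by (simp only: card_residue_class)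
qed

lemma balanced_turan: "r \<ge> 1 \<Longrightarrow> balanced n (n div r) (turan r n)"
  unfolding balanced_def by (auto simp: codeg_turan turan_def)

lemma card_top_codeg_turan:
  assumes "r \<ge> 1"
  shows "card (top_codeg n (n div r) (turan r n)) = (n mod r) * (n div r + 1)"
proof -
  have iff: "codeg n (turan r n) i = n div r + 1 \<longleftrightarrow> i mod r < n mod r" if "i < n" for i
    using codeg_turan[OF assms that] by (cases "i mod r < n mod r") simp_all
  have "top_codeg n (n div r) (turan r n) = (\<Union>c\<in>{..<n mod r}. {j\<in>{..<n}. j mod r = c})"
    by (auto simp: top_codeg_def iff simp del: One_nat_def add_Suc_right)
  also have "card \<dots> = (\<Sum>c\<in>{..<n mod r}. card {j\<in>{..<n}. j mod r = c})"
    by (intro card_UN_disjoint) auto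
  also have "\<dots> = (\<Sum>c\<in>{..<n mod r}. n div r + 1)"
  proof (rule sum.cong[OF refl])
    fix c assume "c \<in> {..<n mod r}"
    then have "c < n mod r" "c < r" using assms by (auto intro: less_trans[OF _ mod_less_divisor])
    then show "card {j\<in>{..<n}. j mod r = c} = n div r + 1" using card_residue_class[of c r n] by simp
  qed
  finally show ?thesis by simp
qed

text \<open>Rayleigh quotient of the all-ones vector: every degree is at least
  \<open>n - a - 1\<close> for \<open>a = n div r\<close>. This is precisely the bound that makes
  \<open>2t + 2a + 1 \<ge> 2n - 1\<close> hold at \<open>t = lam n (turan r n)\<close>.\<close>

lemma lam_turan_ge:
  assumes n: "n \<ge> 1" and r: "r \<ge> 1"
  shows "lam n (turan r n) \<ge> real n - real (n div r) - 1"
proof -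
  let ?T = "turan r n" and ?a = "n div r"
  have "matvec n (adj ?T) (\<lambda>_. 1) i \<ge> real n - ?a - 1" if "i < n" for i
    using matvec_coadj[of n ?T "\<lambda>_. 1" i] sum_coadj[of ?T i n] codeg_turan[OF r that]
    by (auto simp: matvec_def of_bool_def split: if_splits)
  then have "(\<Sum>i<n. real n - ?a - 1) \<le> dot n (\<lambda>_. 1) (matvec n (adj ?T) (\<lambda>_. 1))"
    unfolding dot_def by (intro sum_mono) auto
  also have "\<dots> \<le> lam n ?T * dot n (\<lambda>_. 1) (\<lambda>_. 1)" by (rule rayleigh_le[OF n turan_graph])
  finally have "real n * (real n - ?a - 1) \<le> real n * lam n ?T" by (simp add: dot_def mult.commute)
  then show ?thesis using n by simp
qed

section \<open>From balanced complements to the family\<close>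

lemma deg_in_plus_codeg:
  assumes S: "S \<subseteq> {..<n}" and v: "\<And>u. u < n \<Longrightarrow> \<not> E v u \<Longrightarrow> u \<in> S"
  shows "deg_in E S v + codeg n E v = card S"
proof -
  have fin: "finite S" using S finite_subset by blast
  have "{u\<in>{..<n}. \<not> E v u} = S - {u\<in>S. E v u}" using S v by auto
  then have "codeg n E v = card S - deg_in E S v"
    unfolding codeg_def deg_in_def using fin by (simp add: card_Diff_subset)
  moreover have "deg_in E S v \<le> card S" unfolding deg_in_def using fin by (intro card_mono) auto
  ultimately show ?thesis by simp
qed

text \<open>Take \<open>X\<close> to be the vertices of codegree \<open>a + 1\<close>. Non-adjacent
  vertices share their codegree, so no complement edge runs between \<open>X\<close> and the rest:
  the two sides are completely joined, and inside each side the degree is its size minus the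
  codegree.\<close>

lemma balanced_imp_family_F:
  assumes r: "r \<ge> 1" and b: "balanced n (n div r) E"
    and top_codeg: "card (top_codeg n (n div r) E) = (n mod r) * (n div r + 1)"
  shows "family_F r n E"
proof -
  define a b where "a = n div r" and "b = n mod r"
  define d where "d = r - b"
  have br: "b < r" using r by (simp add: b_def)
  then have rd: "r = b + d" "d \<ge> 1" by (auto simp: d_def)
  have n: "n = (b + d) * a + b" using rd by (simp add: a_def b_def)
  define X where "X = top_codeg n a E"
  define Y where "Y = {..<n} - X"
  have X: "X \<subseteq> {..<n}" by (auto simp: X_def top_codeg_def)
  have cX: "card X = b * (a + 1)" using top_codeg by (simp add: X_def a_def b_def)
  have cY: "card Y = d * a"
    using X cX n unfolding Y_def by (subst card_Diff_subset) (auto intro: finite_subset simp: algebra_simps)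
  have kX: "codeg n E v = a + 1" if "v \<in> X" for v using that by (simp add: X_def top_codeg_def)
  have kY: "codeg n E v = a" if "v \<in> Y" for v
    using that b by (auto simp: Y_def X_def top_codeg_def balanced_def a_def)
  have same: "codeg n E v = codeg n E u" if "v < n" "u < n" "\<not> E v u" for u v
    using b that by (auto simp: balanced_def)
  \<comment> \<open>Kept additive, as is \<open>dY\<close>, so that truncated subtraction enters
    only in the final regularity statements.\<close>
  have dX: "deg_in E X v + (a + 1) = b * (a + 1)" if v: "v \<in> X" for v
  proof -
    have "deg_in E X v + codeg n E v = card X"
      using X v same[of v] kX[OF v] by (intro deg_in_plus_codeg) (auto simp: X_def top_codeg_def a_def)
    then show ?thesis using kX[OF v] cX by simp
  qed
  have dY: "deg_in E Y v + a = d * a" if v: "v \<in> Y" for v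
  proof -
    have "deg_in E Y v + codeg n E v = card Y"
    proof (rule deg_in_plus_codeg)
      fix u assume u: "u < n" "\<not> E v u"
      then have "codeg n E u = a" using same[of v u] v kY[OF v] by (simp add: Y_def)
      then show "u \<in> Y" using u(1) kX[of u] by (auto simp: Y_def)
    qed (auto simp: Y_def)
    then show ?thesis using kY[OF v] cY by simp
  qed
  have regX: "regular_on E X ((b - 1) * (a + 1))"
    unfolding regular_on_def diff_mult_distrib mult_1 using dX by (metis add_diff_cancel_right')
  have regY: "regular_on E Y ((d - 1) * a)"
    unfolding regular_on_def diff_mult_distrib mult_1 using dY by (metis add_diff_cancel_right')
  show ?thesis
  proof (cases "b = 0")
    case True
    then have "X = {}" using cX X finite_subset by fastforce
    then have "Y = {0..<n}" by (auto simp: Y_def)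
    moreover have "d = r" using True by (simp add: d_def)
    ultimately show ?thesis
      using regY True unfolding family_F_def Let_def a_def[symmetric] b_def[symmetric] by simp
  next
    case False
    have "X \<union> Y = {0..<n}" "X \<inter> Y = {}" using X by (auto simp: Y_def)
    moreover have "E x y" if "x \<in> X" "y \<in> Y" for x y
      using same[of x y] kX[OF that(1)] kY[OF that(2)] that X by (auto simp: Y_def)
    ultimately have "\<exists>X Y. X \<union> Y = {0..<n} \<and> X \<inter> Y = {} \<and> card X = b * (a + 1) \<and> card Y = d * a \<and>
        (\<forall>x\<in>X. \<forall>y\<in>Y. E x y) \<and> regular_on E X ((b - 1) * (a + 1)) \<and> regular_on E Y ((d - 1) * a)"
      using cX cY regX regY by (intro exI[of _ X] exI[of _ Y] conjI ballI)
    then show ?thesis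
      using False unfolding family_F_def Let_def a_def[symmetric] b_def[symmetric] d_def by simp
  qed
qed

section \<open>Comparison of the two joins\<close>

text \<open>Beyond \<open>m\<close> the resolvent sum of \<open>E\<close> is at most that of the
  Turan graph, \<open>p\<close>. At \<open>\<rho>\<close> this gives \<open>\<rho> / (\<rho> + s)
  \<le> p \<rho> \<le> p \<tau> = \<tau> / (\<tau> + s)\<close>, so
  \<open>\<rho> \<le> \<tau>\<close>, and the assumed reverse inequality turns everything into
  equality.\<close>

lemma join_comparison:
  assumes r: "r \<ge> 1" and s: "s \<ge> 1" and n: "n \<ge> 1" and G: "is_graph n E"
    and le: "lam n E \<le> lam n (turan r n)"
    and ge: "lam (s + n) (join_empty s n (turan r n)) \<le> lam (s + n) (join_empty s n E)"
  shows "lam n E = lam n (turan r n)"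
    "lam (s + n) (join_empty s n E) = lam (s + n) (join_empty s n (turan r n))"
    "family_F r n E"
proof -
  define a T m where "a = n div r" and "T = turan r n" and "m = lam n T"
  define \<rho> \<tau> where "\<rho> = lam (s + n) (join_empty s n E)" and "\<tau> = lam (s + n) (join_empty s n T)"
  note T = turan_graph[of n r, folded T_def]
  note bal = balanced_turan[OF r, of n, folded T_def a_def]
  define p where "p t = (\<Sum>i<n. 1 / (t + codeg n T i))" for t :: real
  have m0: "m \<ge> 0" unfolding m_def by (rule lam_nonneg[OF n T])
  have ma: "2 * m + 2 * real a + 1 \<ge> 2 * real n - 1"
    using lam_turan_ge[OF n r] unfolding m_def T_def a_def by simp
  have \<tau>m: "\<tau> > m" unfolding \<tau>_def m_def by (rule join_resolvent_sol(1)[OF n s T])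
  have \<rho>\<tau>: "\<rho> \<ge> \<tau>" using ge unfolding \<rho>_def \<tau>_def T_def .
  have \<tau>0: "\<tau> > 0" using \<tau>m m0 by simp
  \<comment> \<open>The solution coming from the join and the explicit one have the same sum, by the
    resolvent identity at equal parameters.\<close>
  have p\<tau>: "p \<tau> = \<tau> / (\<tau> + s)"
  proof -
    obtain y where y: "resolvent_sol n T \<tau> y" "sum y {..<n} = \<tau> / (\<tau> + s)"
      using join_resolvent_sol(2)[OF n s T] unfolding \<tau>_def by blast
    have "resolvent_sol n T \<tau> (\<lambda>i. 1 / (\<tau> + codeg n T i))" using \<tau>0 by (intro balanced_resolvent_sol[OF T bal]) auto
    from resolvent_sol_difference[OF T y(1) this] y(2) show ?thesis by (simp add: p_def)
  qed
  \<comment> \<open>The Turan height is constant, and \<open>p m = 1\<close> identifies its value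
    with the limit bound for \<open>E\<close>.\<close>
  have p: "(t + a) * (t + a + 1) * p t - n * t = (m + a) * (m + a + 1) - n * m" if "t \<ge> 0" for t :: real
    using balanced_sum[OF T bal that] balanced_sum[OF T bal m0] balanced_sum_lam[OF n T bal]
    by (simp add: p_def m_def)
  have "\<exists>Y. \<forall>u. u > lam n E \<longrightarrow> resolvent_sol n E u (Y u)" using ex_resolvent_sol[OF n G] by metis
  then obtain Y where Y: "\<And>u. u > lam n E \<Longrightarrow> resolvent_sol n E u (Y u)" by blast
  have lm: "lam n E \<le> m" using le by (simp add: m_def T_def)
  have \<rho>m: "\<rho> > m" using \<tau>m \<rho>\<tau> by simp
  have Y\<rho>: "sum (Y \<rho>) {..<n} = \<rho> / (\<rho> + s)"
  proof -
    obtain y where y: "resolvent_sol n E \<rho> y" "sum y {..<n} = \<rho> / (\<rho> + s)"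
      using join_resolvent_sol(2)[OF n s G] unfolding \<rho>_def by blast
    from resolvent_sol_difference[OF G y(1) Y[of \<rho>]] y(2) \<rho>m lm show ?thesis by simp
  qed
  have pos: "0 < (\<rho> + a) * (\<rho> + a + 1)" using \<rho>m m0 by (intro mult_pos_pos) auto
  have h: "height n a Y \<rho> \<le> (\<rho> + a) * (\<rho> + a + 1) * p \<rho> - n * \<rho>"
    using height_le_limit[OF n G Y ma lm \<rho>m] p[of \<rho>] \<rho>m m0 by simp
  then have "(\<rho> + a) * (\<rho> + a + 1) * sum (Y \<rho>) {..<n} \<le> (\<rho> + a) * (\<rho> + a + 1) * p \<rho>"
    by (simp add: height_def)
  then have le1: "\<rho> / (\<rho> + s) \<le> p \<rho>" unfolding Y\<rho> mult_le_cancel_left_pos[OF pos] .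
  have le2: "p \<rho> \<le> p \<tau>"
    unfolding p_def using \<tau>0 \<rho>\<tau> by (intro sum_mono divide_left_mono) (auto intro: add_pos_nonneg mult_pos_pos)
  have "\<rho> / (\<rho> + s) \<le> \<tau> / (\<tau> + s)" using le1 le2 p\<tau> by simp
  then have "\<rho> * s \<le> \<tau> * s" using \<tau>0 \<rho>\<tau> by (simp add: field_simps)
  then have eq: "\<rho> = \<tau>" using \<rho>\<tau> s by simp
  have "height n a Y \<rho> = (m + a) * (m + a + 1) - n * m"
    using p[of \<rho>] p\<tau> Y\<rho> \<tau>0 unfolding height_def eq by simp
  note E = height_eq_limit[OF n G Y ma lm \<rho>m this]
  show "lam n E = lam n (turan r n)" using E(1) by (simp add: m_def T_def)
  show "lam (s + n) (join_empty s n E) = lam (s + n) (join_empty s n (turan r n))"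
    using eq by (simp add: \<rho>_def \<tau>_def T_def)
  \<comment> \<open>Both graphs are balanced with the same spectral radius, where both reciprocal
    sums equal 1; comparing the two instances of \<open>balanced_sum\<close> equates the
    counts.\<close>
  have "real (card (top_codeg n a E)) = real (card (top_codeg n a T))"
    using balanced_sum[OF G E(2) m0] balanced_sum_lam[OF n G E(2)] balanced_sum[OF T bal m0] balanced_sum_lam[OF n T bal]
      E(1) by (simp add: m_def)
  then have "card (top_codeg n a E) = card (top_codeg n a T)" by (simp only: of_nat_eq_iff)
  with E(2) show "family_F r n E"
    using card_top_codeg_turan[OF r, of n] unfolding a_def T_def
    by (intro balanced_imp_family_F[OF r]) simp_all
qed

theorem theorem1p5:
  fixes r s n :: nat and E :: "nat \<Rightarrow> nat \<Rightarrow> bool"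
  assumes "r \<ge> 1" and "s \<ge> 1" and "is_graph n E"
  shows "(lam (s + n) (join_empty s n E) \<ge> lam (s + n) (join_empty s n (turan r n)) \<longrightarrow>
            lam n E \<ge> lam n (turan r n) \<and>
            (lam n E = lam n (turan r n) \<longrightarrow>
               family_F r n E \<and>
               lam (s + n) (join_empty s n E) = lam (s + n) (join_empty s n (turan r n))))
       \<and> (lam (s + n) (join_empty s n E) > lam (s + n) (join_empty s n (turan r n)) \<longrightarrow>
            lam n E > lam n (turan r n))
       \<and> (lam (s + n) (join_empty s n E) = lam (s + n) (join_empty s n (turan r n)) \<and>
            lam n E = lam n (turan r n) \<longrightarrow> family_F r n E)"
\<comment> \<open>The Perron arguments require a vertex; on zero vertices the two graphs
  coincide.\<close>
proof (cases "n = 0")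
  case True
  have "E = turan r n"
    using assms(3) True by (auto simp: is_graph_def turan_def fun_eq_iff)
  moreover have "family_F r n E" using True by (simp add: family_F_def regular_on_def)
  ultimately show ?thesis by simp
next
  case False
  then have n: "n \<ge> 1" by simp
  note c = join_comparison[OF assms(1,2) n assms(3)]
  show ?thesis
  proof (intro conjI impI)
    assume ge: "lam (s + n) (join_empty s n E) \<ge> lam (s + n) (join_empty s n (turan r n))"
    \<comment> \<open>By contradiction: a smaller \<open>lam n E\<close> would satisfy the
      hypothesis of the comparison, which then asserts equality. The strict claim below is obtained
      in the same way.\<close>
    show "lam n E \<ge> lam n (turan r n)" using c(1)[OF _ ge] by linarith
    assume "lam n E = lam n (turan r n)"
    then show "family_F r n E"
      "lam (s + n) (join_empty s n E) = lam (s + n) (join_empty s n (turan r n))"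
      using c(2,3)[OF _ ge] by simp_all
  next
    assume "lam (s + n) (join_empty s n E) > lam (s + n) (join_empty s n (turan r n))"
    then show "lam n E > lam n (turan r n)" using c(2) by fastforce
  next
    assume "lam (s + n) (join_empty s n E) = lam (s + n) (join_empty s n (turan r n)) \<and>
      lam n E = lam n (turan r n)"
    then show "family_F r n E" using c(3) by simp
  qed
qed

end
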